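(* Let $M=(S,A,P,R,\gamma,\rho)$ be a Markov decision process with finite state space $S$ and discount factor $\gamma\in[0,1)$, let $\pi$ be a target policy and $\mu$ a behavior policy, let $d_\mu$ be the stationary distribution over states induced by $\mu$, and let $f\in\mathbb{R}^{|S|}$ be defined by $f^\top = d_\mu^\top (I-\gamma P_\pi)^{-1}$, where $f>0$ element-wise. Let $T^\pi v = R_\pi+\gamma P_\pi v$ be the Bellman operator of $\pi$, and let $\Pi_f$ be the projection onto the linear subspace of $\mathbb{R}^{|S|}$ spanned by the features, with respect to the $f$-weighted Euclidean norm. Let $\kappa = \min_{s\in S} \frac{d_\mu(s)}{f(s)}$. Then $\Pi_f T^\pi$ is a $\sqrt{\gamma(1-\kappa)}$-contraction with respect to the $f$-weighted Euclidean norm, namely $$\|\Pi_f T^\pi v_1-\Pi_f T^\pi v_2\|_f\le \sqrt{\gamma(1-\kappa)}\,\|v_1-v_2\|_f,\qquad \forall v_1,v_2\in\mathbb{R}^{|S|}.$$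
   Context: In $M=(S,A,P,R,\gamma,\rho)$, $S$ is the state space, $A$ the action space, $P$ the transition probabilities, $R$ the reward function, $\gamma$ the discount factor and $\rho$ the initial state distribution. A policy $\pi$ assigns to each state $s$ a probability distribution $\pi(\cdot|s)$ on $A$. The matrix $P_\pi\in\mathbb{R}^{|S|\times|S|}$, with entries $P_\pi(s'|s)=\sum_a\pi(a|s)P(s'|s,a)$ (row $s$, column $s'$), and the vector $R_\pi\in\mathbb{R}^{|S|}$, with entries $R_\pi(s)=\sum_a\pi(a|s)R(s,a)$, are the (row-stochastic) transition matrix and reward vector induced by $\pi$; $P_\mu$ is defined likewise. The stationary distribution $d_\mu$ is a probability vector with $d_\mu^\top P_\mu=d_\mu^\top$. The behavior policy generates samples by $a_t\sim\mu(\cdot|s_t)$, $s_{t+1}\sim P(\cdot|s_t,a_t)$, and the ratios $\pi(a_t|s_t)/\mu(a_t|s_t)$ are assumed to be well-defined for all $t$. Each state $s$ has a feature vector $\phi(s)\in\mathbb{R}^n$, and $\Phi\in\mathbb{R}^{n\times|S|}$ is the matrix whose columns are the feature vectors of all states. The subspace spanned by the features is $\{\Phi^\top\theta:\theta\in\mathbb{R}^n\}\subseteq\mathbb{R}^{|S|}$. For $d\in\mathbb{R}^{|S|}$ with $d>0$ element-wise, the $d$-weighted Euclidean norm is $\|v\|_d=\big(\sum_s d(s)v(s)^2\big)^{1/2}$, and $\Pi_d$ is the orthogonal projection onto that subspace with respect to this norm (i.e. $\Pi_d v$ is the minimizer of $\|u-v\|_d$ over $u$ in the subspace). *)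

theory Defs
  imports "HOL-Probability.Probability"
begin

text \<open>
  The states form a finite type. Distributions over states and actions are discrete and given as
  \<open>pmf\<close>; the action type is arbitrary, and sums over actions are \<open>infsum\<close>, which is the ordinary
  sum when there are finitely many actions.
\<close>

record ('s, 'a) mdp =
  transition :: "'s \<Rightarrow> 'a \<Rightarrow> 's pmf"
  reward :: "'s \<Rightarrow> 'a \<Rightarrow> real"
  discount :: real
  init_dist :: "'s pmf"

type_synonym ('s, 'a) policy = "'s \<Rightarrow> 'a pmf"

definition policy_matrix :: "('s::finite, 'a) mdp \<Rightarrow> ('s, 'a) policy \<Rightarrow> real^'s^'s" where
  "policy_matrix M \<pi> =
     (\<chi> s s'. \<Sum>\<^sub>\<infinity>a. pmf (\<pi> s) a * pmf (transition M s a) s')"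

definition policy_reward :: "('s::finite, 'a) mdp \<Rightarrow> ('s, 'a) policy \<Rightarrow> real^'s" where
  "policy_reward M \<pi> = (\<chi> s. \<Sum>\<^sub>\<infinity>a. pmf (\<pi> s) a * reward M s a)"

definition bellman :: "('s::finite, 'a) mdp \<Rightarrow> ('s, 'a) policy \<Rightarrow> real^'s \<Rightarrow> real^'s" where
  "bellman M \<pi> v = policy_reward M \<pi> + discount M *\<^sub>R (policy_matrix M \<pi> *v v)"

definition stationary_distribution ::
    "('s::finite, 'a) mdp \<Rightarrow> ('s, 'a) policy \<Rightarrow> real^'s \<Rightarrow> bool" where
  "stationary_distribution M \<mu> d \<longleftrightarrow>
     (\<forall>s. 0 \<le> d $ s) \<and> (\<Sum>s\<in>UNIV. d $ s) = 1 \<and> d v* policy_matrix M \<mu> = d"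

definition feature_matrix :: "('s::finite \<Rightarrow> real^'n) \<Rightarrow> real^'s^'n" where
  "feature_matrix \<phi> = (\<chi> i s. \<phi> s $ i)"

definition feature_space :: "('s::finite \<Rightarrow> real^'n) \<Rightarrow> (real^'s) set" where
  "feature_space \<phi> = range (\<lambda>\<theta>. transpose (feature_matrix \<phi>) *v \<theta>)"

definition weighted_norm :: "real^'s::finite \<Rightarrow> real^'s \<Rightarrow> real" where
  "weighted_norm d v = sqrt (\<Sum>s\<in>UNIV. d $ s * (v $ s)\<^sup>2)"

text \<open>For positive weights \<open>d\<close> the minimizer over a linear subspace exists and is unique.\<close>

definition weighted_proj :: "real^'s::finite \<Rightarrow> (real^'s) set \<Rightarrow> real^'s \<Rightarrow> real^'s" where
  "weighted_proj d W v = arg_min_on (\<lambda>u. weighted_norm d (u - v)) W"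

end

theory Submission
  imports Defs
begin

text \<open>
  The projection is nonexpansive, so it suffices to bound \<open>\<gamma> P\<^sub>\<pi>\<close>. By Jensen's inequality
  \<open>(P\<^sub>\<pi> x)\<^sup>2 \<le> P\<^sub>\<pi> x\<^sup>2\<close>, and the defining equation of \<open>f\<close> reads \<open>\<gamma> f\<^sup>T P\<^sub>\<pi> = f\<^sup>T - d\<^sub>\<mu>\<^sup>T\<close>, which is
  at most \<open>(1 - \<kappa>) f\<^sup>T\<close>. Summing against \<open>f\<close> gives
  \<open>\<gamma>\<^sup>2 \<parallel>P\<^sub>\<pi> x\<parallel>\<^sup>2 \<le> \<gamma> (1 - \<kappa>) \<parallel>x\<parallel>\<^sup>2\<close> in the \<open>f\<close>-weighted norm.
\<close>

text \<open>Row \<open>s\<close> is the law of the next state when the action is drawn from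
  \<open>\<pi> s\<close>. Identifying it with a \<open>pmf\<close> makes nonnegativity and unit row
  sums immediate, for an arbitrary action type.\<close>

lemma policy_matrix_eq_pmf_bind:
  "policy_matrix M \<pi> $ s $ s' = pmf (bind_pmf (\<pi> s) (transition M s)) s'"
proof -
  let ?g = "\<lambda>a. pmf (\<pi> s) a * pmf (transition M s a) s'"
  have "Infinite_Set_Sum.abs_summable_on ?g UNIV"
    by (rule abs_summable_on_comparison_test[OF pmf_abs_summable[of "\<pi> s"]])
      (simp add: mult_left_le pmf_le_1)
  then have "infsum ?g UNIV = infsetsum ?g UNIV"
    by (simp add: infsetsum_infsum)
  then show ?thesis
    by (simp add: policy_matrix_def pmf_bind pmf_expectation_eq_infsetsum)
qed

lemma policy_matrix_nonneg: "0 \<le> policy_matrix M \<pi> $ s $ s'"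
  by (simp add: policy_matrix_eq_pmf_bind)

lemma policy_matrix_row_sum: "(\<Sum>s'\<in>UNIV. policy_matrix M \<pi> $ s $ s') = 1"
  by (simp add: policy_matrix_eq_pmf_bind sum_pmf_eq_1)

lemma matrix_inv_both:
  fixes A :: "real^'n^'n"
  assumes "invertible A"
  shows "A ** matrix_inv A = mat 1" and "matrix_inv A ** A = mat 1"
  using someI_ex[OF assms[unfolded invertible_def]] by (simp_all add: matrix_inv_def)

text \<open>Maximum principle: a kernel vector satisfies x = \<gamma> P x. Averaging by P cannot
  increase the largest modulus and \<gamma> < 1 shrinks it, so that modulus is zero.\<close>

lemma invertible_mat_1_minus_stochastic:
  fixes P :: "real^'n^'n"
  assumes nonneg: "\<And>i j. 0 \<le> P $ i $ j" and rows: "\<And>i. (\<Sum>j\<in>UNIV. P $ i $ j) = 1"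
    and "0 \<le> \<gamma>" "\<gamma> < 1"
  shows "invertible (mat 1 - \<gamma> *\<^sub>R P)"
proof -
  have "x = 0" if "(mat 1 - \<gamma> *\<^sub>R P) *v x = 0" for x
  proof -
    have x: "x $ i = \<gamma> * (\<Sum>j\<in>UNIV. P $ i $ j * x $ j)" for i
    proof -
      have "x = \<gamma> *\<^sub>R (P *v x)"
        using that by (simp add: matrix_vector_mult_diff_rdistrib scaleR_matrix_vector_assoc)
      then have "x $ i = (\<gamma> *\<^sub>R (P *v x)) $ i" by simp
      then show ?thesis by (simp add: matrix_vector_mult_def)
    qed
    define m where "m = Max (range (\<lambda>i. \<bar>x $ i\<bar>))"
    have le_m: "\<bar>x $ i\<bar> \<le> m" for i
      by (simp add: m_def)
    have "m \<in> range (\<lambda>i. \<bar>x $ i\<bar>)"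
      unfolding m_def by (rule Max_in) auto
    then obtain i where i: "m = \<bar>x $ i\<bar>" by auto
    have "\<bar>\<Sum>j\<in>UNIV. P $ i $ j * x $ j\<bar> \<le> (\<Sum>j\<in>UNIV. P $ i $ j * m)"
      by (rule order_trans[OF sum_abs])
        (auto intro!: sum_mono mult_left_mono simp: abs_mult nonneg le_m)
    also have "\<dots> = m"
      by (simp add: rows flip: sum_distrib_right)
    finally have "m \<le> \<gamma> * m"
      using i x[of i] \<open>0 \<le> \<gamma>\<close> by (metis abs_mult abs_of_nonneg mult_left_mono)
    then have "(1 - \<gamma>) * m \<le> 0"
      by (simp add: algebra_simps)
    then have "m \<le> 0"
      using \<open>\<gamma> < 1\<close> by (simp add: mult_le_0_iff)
    then show ?thesis
      using le_m by (simp add: vec_eq_iff) (meson abs_ge_zero abs_le_zero_iff order_trans)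
  qed
  then show ?thesis
    by (simp add: invertible_left_inverse matrix_left_invertible_ker)
qed

text \<open>The gap between the two sides is the variance of \<open>x\<close> under the weights
  \<open>p\<close>, a weighted sum of squares.\<close>

lemma square_mean_le_mean_square:
  fixes p x :: "'i \<Rightarrow> real"
  assumes "\<And>i. i \<in> I \<Longrightarrow> 0 \<le> p i" "sum p I = 1"
  shows "(\<Sum>i\<in>I. p i * x i)\<^sup>2 \<le> (\<Sum>i\<in>I. p i * (x i)\<^sup>2)"
proof -
  define m where "m = (\<Sum>i\<in>I. p i * x i)"
  have "0 \<le> (\<Sum>i\<in>I. p i * (x i - m)\<^sup>2)"
    by (intro sum_nonneg mult_nonneg_nonneg assms(1)) auto
  also have "\<dots> = (\<Sum>i\<in>I. p i * (x i)\<^sup>2 - 2 * m * (p i * x i) + m\<^sup>2 * p i)"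
    by (rule sum.cong) (auto simp: power2_eq_square algebra_simps)
  also have "\<dots> = (\<Sum>i\<in>I. p i * (x i)\<^sup>2) - m\<^sup>2"
    by (simp add: sum.distrib sum_subtractf assms(2) power2_eq_square m_def
        flip: sum_distrib_left)
  finally show ?thesis by (simp add: m_def)
qed

text \<open>Coordinatewise scaling by \<open>sqrt f\<close> is an isometry from the weighted norm to the Euclidean
  one, so it carries weighted projections to Euclidean closest points.\<close>

definition sqrt_scale :: "real^'s \<Rightarrow> real^'s \<Rightarrow> real^'s" where
  "sqrt_scale f v = (\<chi> s. sqrt (f $ s) * v $ s)"

lemma linear_sqrt_scale: "linear (sqrt_scale f)"
  by (rule linearI) (simp_all add: sqrt_scale_def vec_eq_iff algebra_simps)

lemma weighted_norm_eq_norm_sqrt_scale: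
  assumes "\<And>s. 0 \<le> f $ s"
  shows "weighted_norm f v = norm (sqrt_scale f v)"
  by (simp add: weighted_norm_def sqrt_scale_def norm_vec_def L2_set_def power_mult_distrib assms)

text \<open>The equation compares scaled images because zero weights are allowed here: minimizers in
  \<open>W\<close> may then differ, but they all have the same image, the unique closest
  point.\<close>

lemma sqrt_scale_weighted_proj:
  fixes f :: "real^'s::finite"
  assumes nonneg: "\<And>s. 0 \<le> f $ s" and W: "subspace W"
  shows "sqrt_scale f (weighted_proj f W v) = closest_point (sqrt_scale f ` W) (sqrt_scale f v)"
proof -
  let ?D = "sqrt_scale f"
  have sub: "subspace (?D ` W)"
    by (rule linear_subspace_image[OF linear_sqrt_scale W])
  have norm_D: "weighted_norm f (u - w) = dist (?D w) (?D u)" for u w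
    by (simp add: weighted_norm_eq_norm_sqrt_scale[OF nonneg] linear_diff[OF linear_sqrt_scale]
        dist_norm norm_minus_commute)
  obtain u where "u \<in> W" "?D u = closest_point (?D ` W) (?D v)"
    using closest_point_in_set[OF closed_subspace[OF sub], of "?D v"] subspace_0[OF sub] by force
  \<comment> \<open>A preimage of the closest point witnesses that a minimizer exists, so the choice
    made by \<open>arg_min\<close> is itself a minimizer.\<close>
  then have "is_arg_min (\<lambda>u. weighted_norm f (u - v)) (\<lambda>u. u \<in> W) u"
    using closest_point_le[OF closed_subspace[OF sub], of _ "?D v"]
    by (auto simp: is_arg_min_linorder norm_D)
  then have "is_arg_min (\<lambda>u. weighted_norm f (u - v)) (\<lambda>u. u \<in> W) (weighted_proj f W v)"
    unfolding weighted_proj_def arg_min_on_def arg_min_def by (rule someI)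
  then have "weighted_proj f W v \<in> W"
    "\<forall>z\<in>?D ` W. dist (?D v) (?D (weighted_proj f W v)) \<le> dist (?D v) z"
    by (auto simp: is_arg_min_linorder norm_D)
  then show ?thesis
    by (intro closest_point_unique subspace_imp_convex closed_subspace sub) auto
qed

text \<open>Closest-point maps onto nonempty closed convex sets are 1-Lipschitz; the scaling
  isometry transports this to the weighted norm.\<close>

lemma weighted_proj_nonexpansive:
  assumes nonneg: "\<And>s. 0 \<le> f $ s" and W: "subspace W"
  shows "weighted_norm f (weighted_proj f W v - weighted_proj f W w) \<le> weighted_norm f (v - w)"
proof -
  have sub: "subspace (sqrt_scale f ` W)"
    by (rule linear_subspace_image[OF linear_sqrt_scale W])
  then have "sqrt_scale f ` W \<noteq> {}"
    using subspace_0 by blast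
  with closest_point_lipschitz[OF subspace_imp_convex[OF sub] closed_subspace[OF sub]]
  show ?thesis
    by (simp add: weighted_norm_eq_norm_sqrt_scale[OF nonneg] linear_diff[OF linear_sqrt_scale]
        sqrt_scale_weighted_proj[OF nonneg W] flip: dist_norm)
qed

lemma subspace_feature_space: "subspace (feature_space \<phi>)"
  unfolding feature_space_def
  by (rule linear_subspace_image[OF matrix_vector_mul_linear subspace_UNIV])

lemma weighted_norm_bellman_diff_le:
  fixes f :: "real^'s::finite"
  assumes "0 \<le> discount M" and f: "\<And>s. 0 < f $ s"
    and c: "\<And>s. discount M * (f v* policy_matrix M \<pi>) $ s \<le> c * f $ s"
  shows "weighted_norm f (bellman M \<pi> v - bellman M \<pi> w)
    \<le> sqrt (discount M * c) * weighted_norm f (v - w)"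
proof -
  let ?\<gamma> = "discount M" and ?P = "policy_matrix M \<pi>"
  define x where "x = v - w"
  \<comment> \<open>The reward terms cancel.\<close>
  have "bellman M \<pi> v - bellman M \<pi> w = ?\<gamma> *\<^sub>R (?P *v x)"
    by (simp add: bellman_def x_def matrix_vector_mult_diff_distrib scaleR_diff_right)
  then have "(\<Sum>s\<in>UNIV. f $ s * ((bellman M \<pi> v - bellman M \<pi> w) $ s)\<^sup>2)
      = (\<Sum>s\<in>UNIV. f $ s * (?\<gamma>\<^sup>2 * (\<Sum>s'\<in>UNIV. ?P $ s $ s' * x $ s')\<^sup>2))"
    by (simp add: matrix_vector_mult_def power_mult_distrib)
  also have "\<dots> \<le> (\<Sum>s\<in>UNIV. f $ s * (?\<gamma>\<^sup>2 * (\<Sum>s'\<in>UNIV. ?P $ s $ s' * (x $ s')\<^sup>2)))"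
    using f by (intro sum_mono mult_left_mono square_mean_le_mean_square)
      (auto simp: policy_matrix_nonneg policy_matrix_row_sum less_imp_le)
  also have "\<dots> = (\<Sum>s\<in>UNIV. \<Sum>s'\<in>UNIV. ?\<gamma> * (?\<gamma> * (f $ s * ?P $ s $ s')) * (x $ s')\<^sup>2)"
    by (simp add: sum_distrib_left power2_eq_square mult_ac)
  \<comment> \<open>Swapping the sums moves the matrix from the squares onto \<open>f\<close>. One
    factor \<gamma> is absorbed by the bound \<open>c\<close>; the other survives in the
    constant.\<close>
  also have "\<dots> = (\<Sum>s'\<in>UNIV. ?\<gamma> * (?\<gamma> * (f v* ?P) $ s') * (x $ s')\<^sup>2)"
    by (subst sum.swap)
      (simp add: vector_matrix_mult_def sum_distrib_left sum_distrib_right mult_ac)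
  also have "\<dots> \<le> (\<Sum>s'\<in>UNIV. ?\<gamma> * (c * f $ s') * (x $ s')\<^sup>2)"
    by (intro sum_mono mult_right_mono mult_left_mono c assms(1)) auto
  also have "\<dots> = (?\<gamma> * c) * (\<Sum>s\<in>UNIV. f $ s * (x $ s)\<^sup>2)"
    by (simp add: sum_distrib_left mult_ac)
  finally show ?thesis
    unfolding weighted_norm_def x_def real_sqrt_mult[symmetric] by simp
qed

theorem theorem1:
  fixes M :: "('s::finite, 'a) mdp"
    and \<pi> \<mu> :: "('s, 'a) policy"
    and \<phi> :: "'s \<Rightarrow> real^'n"
    and d\<^sub>\<mu> f v\<^sub>1 v\<^sub>2 :: "real^'s"
    and \<kappa> :: real
  assumes "0 \<le> discount M" and "discount M < 1"
    and "stationary_distribution M \<mu> d\<^sub>\<mu>"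
    and "f = d\<^sub>\<mu> v* matrix_inv (mat 1 - discount M *\<^sub>R policy_matrix M \<pi>)"
    and "\<And>s. 0 < f $ s"
    and "\<kappa> = Min (range (\<lambda>s. d\<^sub>\<mu> $ s / f $ s))"
  shows "weighted_norm f (weighted_proj f (feature_space \<phi>) (bellman M \<pi> v\<^sub>1)
             - weighted_proj f (feature_space \<phi>) (bellman M \<pi> v\<^sub>2))
         \<le> sqrt (discount M * (1 - \<kappa>)) * weighted_norm f (v\<^sub>1 - v\<^sub>2)"
proof -
  let ?\<gamma> = "discount M" and ?P = "policy_matrix M \<pi>"
  let ?A = "mat 1 - ?\<gamma> *\<^sub>R ?P"
  \<comment> \<open>Only for an invertible matrix does \<open>matrix_inv\<close> denote a true
    inverse, so that the equation for \<open>f\<close> can be multiplied through by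
    \<open>?A\<close>.\<close>
  have "invertible ?A"
    by (intro invertible_mat_1_minus_stochastic policy_matrix_nonneg policy_matrix_row_sum assms)
  then have "f v* ?A = d\<^sub>\<mu>"
    using assms(4) by (simp add: vector_matrix_mul_assoc matrix_inv_both)
  moreover have "f v* ?A = f v* mat 1 - f v* (?\<gamma> *\<^sub>R ?P)"
    by (simp add: vec_eq_iff vector_matrix_mult_def algebra_simps sum_subtractf)
  moreover have "f v* (?\<gamma> *\<^sub>R ?P) = ?\<gamma> *\<^sub>R (f v* ?P)"
    by (simp add: vec_eq_iff vector_matrix_mult_def sum_distrib_left mult_ac)
  ultimately have "f - ?\<gamma> *\<^sub>R (f v* ?P) = d\<^sub>\<mu>"
    by simp
  then have step: "?\<gamma> * (f v* ?P) $ s = f $ s - d\<^sub>\<mu> $ s" for s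
    by (auto simp: vec_eq_iff algebra_simps)
  have "\<kappa> \<le> d\<^sub>\<mu> $ s / f $ s" for s
    by (simp add: assms(6))
  then have "\<kappa> * f $ s \<le> d\<^sub>\<mu> $ s" for s
    using assms(5) by (metis pos_le_divide_eq)
  \<comment> \<open>This is the bound \<open>c\<close> of the Bellman estimate, with
    \<open>c = 1 - \<kappa>\<close>.\<close>
  then have "?\<gamma> * (f v* ?P) $ s \<le> (1 - \<kappa>) * f $ s" for s
    by (simp add: step algebra_simps)
  then have "weighted_norm f (bellman M \<pi> v\<^sub>1 - bellman M \<pi> v\<^sub>2)
      \<le> sqrt (?\<gamma> * (1 - \<kappa>)) * weighted_norm f (v\<^sub>1 - v\<^sub>2)"
    by (intro weighted_norm_bellman_diff_le assms)
  with weighted_proj_nonexpansive[OF less_imp_le[OF assms(5)] subspace_feature_space]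
  show ?thesis
    by (rule order_trans)
qed

end
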